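(* Let $G=\prod_{j=0}^{\infty}Z_2$ be the dyadic group with its Haar probability measure $\mu$. For a martingale $F\in H_1(G)$ define the weighted maximal operator of the partial sums of its Walsh–Fourier series by $$\widetilde{S}^{\ast,\nabla}F:=\sup_{n\in\mathbb{N}_+}\frac{|S_nF|}{V(n)}.$$ Then: (a) $\widetilde{S}^{\ast,\nabla}$ is bounded from the Hardy space $H_1(G)$ to the space $\text{weak-}L_1(G)$; that is, there is an absolute constant $C>0$ such that for all $F\in H_1(G)$, $$\sup_{t>0}\, t\,\mu\left\{x\in G:\widetilde{S}^{\ast,\nabla}F(x)>t\right\}\le C\,\|F\|_{H_1}.$$ (b) $\widetilde{S}^{\ast,\nabla}$ is not bounded from the Hardy space $H_1(G)$ to the space $L_1(G)$; that is, there is no constant $C>0$ such that $\|\widetilde{S}^{\ast,\nabla}F\|_{1}\le C\|F\|_{H_1}$ for all $F\in H_1(G)$.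
   Context: $\mathbb{N}_+$ is the set of positive integers and $\mathbb{N}=\mathbb{N}_+\cup\{0\}$. $Z_2=\{0,1\}$ is the discrete cyclic group of order 2 with addition modulo 2 and Haar measure giving each singleton measure $1/2$. $G$ is the complete direct product of countably many copies of $Z_2$, with the product topology and product (Haar) measure $\mu$; its elements are sequences $x=(x_0,x_1,\dots)$ with $x_k\in\{0,1\}$. Dyadic intervals are $I_0(x)=G$ and $I_n(x)=\{y\in G: y_0=x_0,\dots,y_{n-1}=x_{n-1}\}$. Every $n\in\mathbb{N}$ is written uniquely as $n=\sum_{k=0}^{\infty}n_k2^k$ with $n_k\in\{0,1\}$, only finitely many nonzero. The variation of $n$ is $$V(n):=n_0+\sum_{k=1}^{\infty}|n_k-n_{k-1}|.$$ (So $V(n)\ge 1$ for $n\ge 1$.) Walsh system: $r_k(x)=(-1)^{x_k}$ and $w_n(x)=\prod_{k=0}^{\infty}r_k(x)^{n_k}=(-1)^{\sum_k n_kx_k}$ for $n\in\mathbb{N}$. Let $\zeta_n$ be the $\sigma$-algebra generated by the intervals $\{I_n(x):x\in G\}$. A martingale $F=(F_n,n\in\mathbb{N})$ is a martingale with respect to $(\zeta_n)_{n\in\mathbb{N}}$. Its maximal function is $F^{\ast}=\sup_{n\in\mathbb{N}}|F_n|$. The Hardy martingale space $H_1(G)$ consists of all martingales $F$ with $\|F\|_{H_1}:=\|F^{\ast}\|_1=\int_G F^{\ast}\,d\mu<\infty$. The Walsh–Fourier coefficients of a martingale $F$ are $\widehat F(k)=\lim_{n\to\infty}\int_GF_n w_k\,d\mu$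 (the limit exists), and the partial sums are $S_nF=\sum_{k=0}^{n-1}\widehat F(k)w_k$ for $n\in\mathbb{N}_+$. *)

theory Defs
  imports "HOL-Probability.Probability" "HOL-Library.Z2"
begin

type_synonym dyadic_group = "nat \<Rightarrow> bit"

definition haar :: "dyadic_group measure" where
  "haar = Pi\<^sub>M UNIV (\<lambda>_. uniform_count_measure UNIV)"

definition dyadic_interval :: "nat \<Rightarrow> dyadic_group \<Rightarrow> dyadic_group set" where
  "dyadic_interval n x = {y. \<forall>k<n. y k = x k}"

text \<open>Only the space and the measurable sets of \<open>sigma\<close> are used below: it carries the zero measure.\<close>

definition dyadic_algebra :: "nat \<Rightarrow> dyadic_group measure" where
  "dyadic_algebra n = sigma UNIV (range (dyadic_interval n))"

text \<open>The binary digit \<open>n\<^sub>k\<close> of \<open>n\<close> is \<open>of_bool (bit n k)\<close>. All but finitely many digits vanish,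
  so the series in \<open>variation\<close> and the product in \<open>walsh\<close> are finite.\<close>

lemma finite_bits_nat: "finite {k. bit (n::nat) k}"
proof (rule finite_subset)
  show "{k. bit n k} \<subseteq> {..<n}"
  proof
    fix k assume "k \<in> {k. bit n k}"
    then have "2 ^ k \<le> n"
      by (auto simp: bit_iff_odd intro: ccontr)
    with less_exp[of k] have "k < n"
      by (rule less_le_trans)
    then show "k \<in> {..<n}"
      by simp
  qed
qed simp

definition variation :: "nat \<Rightarrow> real" where
  "variation n = of_bool (bit n 0) +
     (\<Sum>k. \<bar>of_bool (bit n (Suc k)) - of_bool (bit n k)\<bar>)"

definition rademacher :: "nat \<Rightarrow> dyadic_group \<Rightarrow> real" where
  "rademacher k x = (if x k = 1 then - 1 else 1)"

definition walsh :: "nat \<Rightarrow> dyadic_group \<Rightarrow> real" where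
  "walsh n x = (\<Prod>k | bit n k. rademacher k x)"

text \<open>Martingales take values in the scalar field \<open>'a\<close>. Up to isomorphism the sort constraint
  leaves the real and the complex numbers, so that both readings are covered. The last clause says
  that \<open>F m\<close> is a conditional expectation of \<open>F n\<close> given \<open>dyadic_algebra m\<close>; it is written out
  because \<open>real_cond_exp\<close> is limited to real functions.\<close>

definition dyadic_martingale ::
    "(nat \<Rightarrow> dyadic_group \<Rightarrow> 'a::{real_normed_field,banach,second_countable_topology}) \<Rightarrow> bool" where
  "dyadic_martingale F \<longleftrightarrow>
     (\<forall>n. F n \<in> borel_measurable (dyadic_algebra n)) \<and>
     (\<forall>n. integrable haar (F n)) \<and>
     (\<forall>m n. m \<le> n \<longrightarrow> (\<forall>A\<in>sets (dyadic_algebra m).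
        set_lebesgue_integral haar A (F n) = set_lebesgue_integral haar A (F m)))"

definition maximal_function ::
    "(nat \<Rightarrow> dyadic_group \<Rightarrow> 'a::real_normed_vector) \<Rightarrow> dyadic_group \<Rightarrow> ennreal" where
  "maximal_function F x = (SUP n. ennreal (norm (F n x)))"

text \<open>Maximal functions may be infinite at some points, so \<open>L\<^sub>1\<close> and weak \<open>L\<^sub>1\<close> norms are
  stated for functions with values in \<open>[0, \<infinity>]\<close>.\<close>

definition L1_norm :: "(dyadic_group \<Rightarrow> ennreal) \<Rightarrow> ennreal" where
  "L1_norm f = (\<integral>\<^sup>+ x. f x \<partial>haar)"

definition weak_L1_norm :: "(dyadic_group \<Rightarrow> ennreal) \<Rightarrow> ennreal" where
  "weak_L1_norm f =
     (SUP t\<in>{0::real<..}. ennreal t * emeasure haar {x \<in> space haar. f x > ennreal t})"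

definition H1_norm :: "(nat \<Rightarrow> dyadic_group \<Rightarrow> 'a::real_normed_vector) \<Rightarrow> ennreal" where
  "H1_norm F = L1_norm (maximal_function F)"

definition hardy_H1 ::
    "(nat \<Rightarrow> dyadic_group \<Rightarrow> 'a::{real_normed_field,banach,second_countable_topology}) set" where
  "hardy_H1 = {F. dyadic_martingale F \<and> H1_norm F < \<infinity>}"

definition walsh_coeff ::
    "(nat \<Rightarrow> dyadic_group \<Rightarrow> 'a::{real_normed_field,banach,second_countable_topology}) \<Rightarrow> nat \<Rightarrow> 'a" where
  "walsh_coeff F k = lim (\<lambda>n. LINT x|haar. walsh k x *\<^sub>R F n x)"

definition walsh_partial_sum ::
    "nat \<Rightarrow> (nat \<Rightarrow> dyadic_group \<Rightarrow> 'a::{real_normed_field,banach,second_countable_topology})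
       \<Rightarrow> dyadic_group \<Rightarrow> 'a" where
  "walsh_partial_sum n F x = (\<Sum>k<n. walsh k x *\<^sub>R walsh_coeff F k)"

definition weighted_maximal ::
    "(nat \<Rightarrow> dyadic_group \<Rightarrow> 'a::{real_normed_field,banach,second_countable_topology})
       \<Rightarrow> dyadic_group \<Rightarrow> ennreal" where
  "weighted_maximal F x = (SUP n\<in>{1..}. ennreal (norm (walsh_partial_sum n F x) / variation n))"

end

theory Submission
  imports Defs
begin

text \<open>
  Write \<open>D\<^sub>n = w\<^sub>0 + \<dots> + w\<^sub>n\<^sub>-\<^sub>1\<close> for the Dirichlet kernel and \<open>n\<^sub>0, n\<^sub>1, \<dots>\<close> for the binary digits of \<open>n\<close>.

  The weak type bound rests on the kernel formula \<open>dirichlet_kernel_eq\<close>: up to the factor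
  \<open>w\<^sub>n = \<plusminus>1\<close>, \<open>D\<^sub>n\<close> is the combination of the averaging kernels \<open>2\<^sup>k 1\<^bsub>I\<^sub>k(0)\<^esub>\<close> with the
  coefficients \<open>- n\<^sub>0\<close> for \<open>k = 0\<close> and \<open>n\<^sub>k\<^sub>-\<^sub>1 - n\<^sub>k\<close> for \<open>k \<ge> 1\<close>. The absolute values of these
  coefficients add up to \<open>V(n)\<close>. Now \<open>S\<^sub>n F\<close> is the convolution of \<open>D\<^sub>n\<close> with any \<open>F\<^sub>N\<close> such that
  \<open>n < 2\<^sup>N\<close>, and \<open>|F\<^sub>N|\<close> is at most the maximal function \<open>F\<^sup>*\<close>. So \<open>|S\<^sub>n F| / V(n)\<close> is at
  most the largest dyadic average of \<open>F\<^sup>*\<close>, for every \<open>n\<close>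
  (\<open>weighted_maximal_le_dyadic_maximal\<close>). The dyadic maximal operator has weak type \<open>(1, 1)\<close> with
  constant 1 (\<open>dyadic_maximal_weak_type\<close>), and the integral of \<open>F\<^sup>*\<close> is the \<open>H\<^sub>1\<close> norm of \<open>F\<close>.

  The strong bound fails on the dyadic atoms \<open>a\<^sub>m = r\<^sub>m D\<^bsub>2^m\<^esub>\<close>, which have \<open>H\<^sub>1\<close> norm at most 1.
  The Walsh coefficients of \<open>a\<^sub>m\<close> vanish below \<open>2\<^sup>m\<close> and are 1 from there up to \<open>2\<^sup>m\<^sup>+\<^sup>1\<close>, hence
  its partial sum of order \<open>2\<^sup>m + 2\<^sup>k\<close> is \<open>r\<^sub>m D\<^bsub>2^k\<^esub>\<close>, of modulus \<open>2\<^sup>k\<close> on \<open>I\<^sub>k(0)\<close>, when \<open>k < m\<close>.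
  As \<open>2\<^sup>m + 2\<^sup>k\<close> has two nonzero digits, its variation is at most 4. The weighted maximal
  function is therefore at least \<open>2\<^sup>k / 4\<close> on \<open>I\<^sub>k(0)\<close> for every \<open>k < m\<close>. Each of these
  \<open>m\<close> scales contributes the same amount to its integral, which grows linearly in \<open>m\<close> (\<open>L1_norm_weighted_maximal_atom_ge\<close>).
\<close>

section \<open>Dyadic intervals and Haar measure\<close>

lemma UNIV_bit: "(UNIV :: bit set) = {0, 1}"
  using bit_not_zero_iff by auto

lemma finite_bit: "finite (UNIV :: bit set)" and card_bit: "card (UNIV :: bit set) = 2"
  by (simp_all add: UNIV_bit)

lemma mem_dyadic_interval: "y \<in> dyadic_interval n x \<longleftrightarrow> (\<forall>k<n. y k = x k)"
  by (simp add: dyadic_interval_def)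

lemma dyadic_interval_cong:
  assumes "y \<in> dyadic_interval n x"
  shows "dyadic_interval n y = dyadic_interval n x"
  using assms by (auto simp: dyadic_interval_def)

lemma dyadic_interval_antimono:
  assumes "m \<le> n"
  shows "dyadic_interval n x \<subseteq> dyadic_interval m x"
  using assms by (auto simp: dyadic_interval_def)

lemma finite_range_dyadic_interval: "finite (range (dyadic_interval n))"
proof (rule finite_surj)
  show "finite (PiE {..<n} (\<lambda>_. UNIV :: bit set))"
    by (rule finite_PiE) (auto simp: finite_bit)
  show "range (dyadic_interval n) \<subseteq> dyadic_interval n ` PiE {..<n} (\<lambda>_. UNIV)"
  proof
    fix I assume "I \<in> range (dyadic_interval n)"
    then obtain x where "I = dyadic_interval n x" by blast
    then have "I = dyadic_interval n (restrict x {..<n})"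
      by (auto simp: dyadic_interval_def)
    then show "I \<in> dyadic_interval n ` PiE {..<n} (\<lambda>_. UNIV)" by auto
  qed
qed

lemma disjoint_dyadic_intervals: "disjoint (range (dyadic_interval n))"
proof -
  have "dyadic_interval n x = dyadic_interval n y"
    if "z \<in> dyadic_interval n x" "z \<in> dyadic_interval n y" for x y z
    using that[THEN dyadic_interval_cong] by simp
  then show ?thesis unfolding disjoint_def by blast
qed

lemma prob_space_bit: "prob_space (uniform_count_measure (UNIV :: bit set))"
  by (rule prob_space_uniform_count_measure) (auto simp: finite_bit)

lemma prob_space_haar: "prob_space haar"
  unfolding haar_def by (rule prob_space_PiM) (rule prob_space_bit)

lemma space_haar [simp]: "space haar = UNIV"
  by (simp add: haar_def space_PiM space_uniform_count_measure)

lemma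
  shows sets_dyadic_interval [measurable]: "dyadic_interval n x \<in> sets haar"
    and emeasure_dyadic_interval: "emeasure haar (dyadic_interval n x) = ennreal (1 / 2 ^ n)"
proof -
  let ?B = "uniform_count_measure (UNIV :: bit set)"
  interpret B: prob_space ?B by (rule prob_space_bit)
  interpret P: product_prob_space "\<lambda>_. ?B" "UNIV :: nat set" ..
  have eq: "dyadic_interval n x = prod_emb UNIV (\<lambda>_. ?B) {..<n} (PiE {..<n} (\<lambda>k. {x k}))"
  proof (rule set_eqI)
    fix y
    have "y \<in> prod_emb UNIV (\<lambda>_. ?B) {..<n} (PiE {..<n} (\<lambda>k. {x k}))
      \<longleftrightarrow> (\<forall>k\<in>{..<n}. restrict y {..<n} k \<in> {x k})"
      by (simp only: prod_emb_def PiE_iff space_uniform_count_measure restrict_extensional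
          vimage_eq Int_iff simp_thms UNIV_I PiE_UNIV_domain Pi_UNIV)
    then show "y \<in> dyadic_interval n x \<longleftrightarrow>
        y \<in> prod_emb UNIV (\<lambda>_. ?B) {..<n} (PiE {..<n} (\<lambda>k. {x k}))"
      by (simp only: dyadic_interval_def mem_Collect_eq Ball_def lessThan_iff
          restrict_apply' singleton_iff cong: conj_cong imp_cong)
  qed
  show "dyadic_interval n x \<in> sets haar"
    unfolding eq haar_def by (rule sets_PiM_I) (auto simp: sets_uniform_count_measure)
  have half: "emeasure ?B {b} = ennreal (1 / 2)" for b
    by (simp add: emeasure_uniform_count_measure finite_bit card_bit)
  have "emeasure haar (dyadic_interval n x) = (\<Prod>k<n. emeasure ?B {x k})"
    unfolding eq haar_def
    by (rule P.emeasure_PiM_emb) (auto simp: sets_uniform_count_measure)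
  also have "\<dots> = ennreal (1 / 2 ^ n)"
    unfolding half by (subst prod_ennreal) (auto simp: power_one_over)
  finally show "emeasure haar (dyadic_interval n x) = ennreal (1 / 2 ^ n)" .
qed

lemma measure_dyadic_interval: "measure haar (dyadic_interval n x) = 1 / 2 ^ n"
  by (simp add: measure_def emeasure_dyadic_interval)

lemma Union_dyadic_intervals:
  assumes "\<And>x y. x \<in> A \<Longrightarrow> y \<in> dyadic_interval n x \<Longrightarrow> y \<in> A"
  shows "A = \<Union>(dyadic_interval n ` A)"
  using assms by (auto simp: mem_dyadic_interval)

text \<open>There are only finitely many intervals of rank \<open>n\<close>, so the algebra consists of all unions of
  them. With this description, measurability and the martingale property become statements about
  the first \<open>n\<close> coordinates.\<close>

lemma sets_dyadic_algebra_iff: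
  "A \<in> sets (dyadic_algebra n) \<longleftrightarrow> (\<forall>x\<in>A. dyadic_interval n x \<subseteq> A)"
proof
  assume "A \<in> sets (dyadic_algebra n)"
  then have "A \<in> sigma_sets UNIV (range (dyadic_interval n))"
    by (simp add: dyadic_algebra_def)
  then have "x \<in> A \<longleftrightarrow> y \<in> A" if "y \<in> dyadic_interval n x" for x y
    using that
  proof (induction arbitrary: x y)
    case (Basic I)
    then show ?case by (auto simp: dyadic_interval_def)
  qed auto
  then show "\<forall>x\<in>A. dyadic_interval n x \<subseteq> A" by blast
next
  assume *: "\<forall>x\<in>A. dyadic_interval n x \<subseteq> A"
  have "\<Union>(dyadic_interval n ` A) \<in> sets (dyadic_algebra n)"
  proof (rule sets.finite_Union)
    show "finite (dyadic_interval n ` A)"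
      by (rule finite_subset[OF _ finite_range_dyadic_interval[of n]]) auto
  qed (auto simp: dyadic_algebra_def)
  moreover have "A = \<Union>(dyadic_interval n ` A)"
    by (rule Union_dyadic_intervals) (use * in blast)
  ultimately show "A \<in> sets (dyadic_algebra n)" by simp
qed

lemma sets_dyadic_algebra_subset: "sets (dyadic_algebra n) \<subseteq> sets haar"
proof -
  have "sigma_sets (space haar) (range (dyadic_interval n)) \<subseteq> sets haar"
    by (rule sets.sigma_sets_subset) auto
  then show ?thesis by (simp add: dyadic_algebra_def)
qed

lemma sets_dyadic_algebra_mono:
  assumes "m \<le> n"
  shows "sets (dyadic_algebra m) \<subseteq> sets (dyadic_algebra n)"
  using dyadic_interval_antimono[OF assms] unfolding sets_dyadic_algebra_iff subset_iff by blast

lemma measurable_dyadic_algebra: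
  fixes f :: "dyadic_group \<Rightarrow> 'b::topological_space"
  assumes "\<And>x y. y \<in> dyadic_interval n x \<Longrightarrow> f y = f x"
  shows "f \<in> borel_measurable (dyadic_algebra n)"
proof (rule measurableI)
  fix A :: "'b set"
  show "f -` A \<inter> space (dyadic_algebra n) \<in> sets (dyadic_algebra n)"
    unfolding sets_dyadic_algebra_iff using assms by (auto simp: dyadic_algebra_def)
qed simp

lemma measurable_haar_if_prefix:
  fixes f :: "dyadic_group \<Rightarrow> 'b::topological_space"
  assumes "\<And>x y. y \<in> dyadic_interval n x \<Longrightarrow> f y = f x"
  shows "f \<in> borel_measurable haar"
proof -
  have "space (dyadic_algebra n) = space haar" by (simp add: dyadic_algebra_def)
  with measurable_dyadic_algebra[of n f] assms sets_dyadic_algebra_subset[of n] show ?thesis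
    by (auto simp: measurable_def)
qed

section \<open>The dyadic maximal operator\<close>

text \<open>The factor \<open>2\<^sup>k\<close> is the inverse of the measure of an interval of rank \<open>k\<close>: the operator takes
  the largest average of \<open>g\<close> over the dyadic intervals around \<open>x\<close>.\<close>

definition dyadic_maximal :: "(dyadic_group \<Rightarrow> ennreal) \<Rightarrow> dyadic_group \<Rightarrow> ennreal" where
  "dyadic_maximal g x = (SUP k. 2 ^ k * (\<integral>\<^sup>+ t \<in> dyadic_interval k x. g t \<partial>haar))"

lemma emeasure_le_nn_integral_if_intervals:
  fixes g :: "dyadic_group \<Rightarrow> ennreal"
  assumes [measurable]: "g \<in> borel_measurable haar"
    and A: "A \<in> sets (dyadic_algebra n)"
    and le: "\<And>x. x \<in> A \<Longrightarrow>
      c * emeasure haar (dyadic_interval n x) \<le> (\<integral>\<^sup>+ t \<in> dyadic_interval n x. g t \<partial>haar)"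
  shows "c * emeasure haar A \<le> (\<integral>\<^sup>+ t \<in> A. g t \<partial>haar)"
proof -
  let ?D = "dyadic_interval n ` A"
  have fin: "finite ?D"
    by (rule finite_subset[OF _ finite_range_dyadic_interval[of n]]) auto
  have disj: "disjoint ?D"
    using disjoint_dyadic_intervals[of n] by (auto simp: disjoint_def)
  have A_eq: "A = \<Union>?D"
    by (rule Union_dyadic_intervals) (use A in \<open>auto simp: sets_dyadic_algebra_iff\<close>)
  have em: "emeasure M A = (\<Sum>I\<in>?D. emeasure M I)" if "sets M = sets haar" for M
  proof -
    have "(\<Sum>I\<in>?D. emeasure M I) = emeasure M (\<Union>I\<in>?D. I)"
      using fin disj by (intro sum_emeasure) (auto simp: that disjoint_def disjoint_family_on_def)
    with A_eq show ?thesis by simp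
  qed
  have "c * emeasure haar A = (\<Sum>I\<in>?D. c * emeasure haar I)"
    by (simp add: em sum_distrib_left)
  also have "\<dots> \<le> (\<Sum>I\<in>?D. emeasure (density haar g) I)"
    using le by (intro sum_mono) (auto simp: emeasure_density)
  also have "\<dots> = emeasure (density haar g) A"
    by (simp add: em)
  also have "\<dots> = (\<integral>\<^sup>+ t \<in> A. g t \<partial>haar)"
    using A sets_dyadic_algebra_subset by (intro emeasure_density) auto
  finally show ?thesis .
qed

text \<open>The averages over the intervals of rank \<open>k\<close> are constant on each of these intervals, so
  the set is a countable union of sets from the algebras.\<close>

lemma sets_dyadic_maximal_greater: "{x. dyadic_maximal g x > c} \<in> sets haar"
proof -
  have "{x. 2 ^ k * (\<integral>\<^sup>+ t \<in> dyadic_interval k x. g t \<partial>haar) > c} \<in> sets (dyadic_algebra k)" for k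
    unfolding sets_dyadic_algebra_iff using dyadic_interval_cong by auto
  then have "(\<Union>k. {x. 2 ^ k * (\<integral>\<^sup>+ t \<in> dyadic_interval k x. g t \<partial>haar) > c}) \<in> sets haar"
    using sets_dyadic_algebra_subset by (intro sets.countable_UN) blast
  moreover have "{x. dyadic_maximal g x > c}
      = (\<Union>k. {x. 2 ^ k * (\<integral>\<^sup>+ t \<in> dyadic_interval k x. g t \<partial>haar) > c})"
    by (auto simp: dyadic_maximal_def less_SUP_iff)
  ultimately show ?thesis by simp
qed

text \<open>A stopping time argument. Each point where the maximal function exceeds \<open>c\<close> is sorted by the
  first rank at which the average around it exceeds \<open>c\<close>. The points with first rank \<open>k\<close> form a
  union of intervals of rank \<open>k\<close>, on each of which \<open>g\<close> has average above \<open>c\<close>; and the sets for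
  different \<open>k\<close> are disjoint, so that their estimates add up.\<close>

lemma dyadic_maximal_weak_type:
  fixes g :: "dyadic_group \<Rightarrow> ennreal"
  assumes [measurable]: "g \<in> borel_measurable haar"
  shows "c * emeasure haar {x. dyadic_maximal g x > c} \<le> (\<integral>\<^sup>+ t. g t \<partial>haar)"
proof -
  define U where "U k = {x. c < 2 ^ k * (\<integral>\<^sup>+ t \<in> dyadic_interval k x. g t \<partial>haar)}" for k
  let ?V = "disjointed U"
  have U_sets: "U k \<in> sets (dyadic_algebra k)" for k
    unfolding sets_dyadic_algebra_iff U_def using dyadic_interval_cong by auto
  have V_sets: "?V k \<in> sets (dyadic_algebra k)" for k
    unfolding disjointed_def
    by (intro sets.Diff sets.finite_UN U_sets subsetD[OF sets_dyadic_algebra_mono U_sets]) auto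
  have V_haar [measurable]: "?V k \<in> sets haar" for k
    using V_sets sets_dyadic_algebra_subset by blast
  have V_le: "c * emeasure haar (?V k) \<le> emeasure (density haar g) (?V k)" for k
  proof -
    have "c * emeasure haar (?V k) \<le> (\<integral>\<^sup>+ t \<in> ?V k. g t \<partial>haar)"
    proof (rule emeasure_le_nn_integral_if_intervals)
      fix x assume "x \<in> ?V k"
      then have "x \<in> U k" using disjointed_subset[of U k] by blast
      then have "c \<le> 2 ^ k * (\<integral>\<^sup>+ t \<in> dyadic_interval k x. g t \<partial>haar)"
        by (simp add: U_def less_imp_le)
      then have "c * ennreal (1 / 2 ^ k) \<le>
          ennreal (2 ^ k) * (\<integral>\<^sup>+ t \<in> dyadic_interval k x. g t \<partial>haar) * ennreal (1 / 2 ^ k)"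
        by (intro mult_right_mono) (auto simp: ennreal_power[symmetric])
      also have "\<dots> = (\<integral>\<^sup>+ t \<in> dyadic_interval k x. g t \<partial>haar)
          * (ennreal (2 ^ k) * ennreal (1 / 2 ^ k))"
        by (simp add: ac_simps)
      also have "ennreal (2 ^ k) * ennreal (1 / 2 ^ k) = 1"
        by (subst ennreal_mult[symmetric]) auto
      finally show "c * emeasure haar (dyadic_interval k x) \<le>
          (\<integral>\<^sup>+ t \<in> dyadic_interval k x. g t \<partial>haar)"
        by (simp add: emeasure_dyadic_interval)
    qed (use V_sets in auto)
    then show ?thesis by (simp add: emeasure_density)
  qed
  have "{x. dyadic_maximal g x > c} = (\<Union>k. ?V k)"
    by (auto simp: UN_disjointed_eq U_def dyadic_maximal_def less_SUP_iff)
  then have "c * emeasure haar {x. dyadic_maximal g x > c} = c * (\<Sum>k. emeasure haar (?V k))"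
    by (subst suminf_emeasure) (auto simp: disjoint_family_disjointed)
  also have "\<dots> = (\<Sum>k. c * emeasure haar (?V k))"
    by simp
  also have "\<dots> \<le> (\<Sum>k. emeasure (density haar g) (?V k))"
    by (intro suminf_le V_le) auto
  also have "\<dots> = emeasure (density haar g) (\<Union>k. ?V k)"
    by (intro suminf_emeasure) (auto simp: disjoint_family_disjointed)
  also have "\<dots> \<le> emeasure (density haar g) (space (density haar g))"
    by (rule emeasure_space)
  also have "\<dots> = (\<integral>\<^sup>+ t. g t \<partial>haar)"
    using sets.top[of haar] by (subst emeasure_density) auto
  finally show ?thesis .
qed

section \<open>Walsh functions and the Dirichlet kernel\<close>

lemma bit_nat_imp_less:
  assumes "n < 2 ^ N" "bit (n::nat) k"
  shows "k < N"
proof (rule ccontr)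
  assume "\<not> k < N"
  then have "n < 2 ^ k"
    using assms(1) by (meson le_less_linear less_le_trans one_le_numeral power_increasing)
  with assms(2) show False by (simp add: bit_iff_odd)
qed

lemma walsh_cases: "walsh n x = 1 \<or> walsh n x = - 1"
proof -
  have "\<bar>walsh n x\<bar> = 1"
    unfolding walsh_def abs_prod by (rule prod.neutral) (auto simp: rademacher_def)
  then show ?thesis by linarith
qed

lemma walsh_cong:
  assumes "n < 2 ^ N" "y \<in> dyadic_interval N x"
  shows "walsh n y = walsh n x"
  unfolding walsh_def
  by (rule prod.cong) (use assms bit_nat_imp_less in \<open>auto simp: rademacher_def mem_dyadic_interval\<close>)

lemma measurable_walsh [measurable]: "walsh n \<in> borel_measurable haar"
  by (rule measurable_haar_if_prefix[of n]) (rule walsh_cong, auto)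

lemma walsh_add: "walsh n (\<lambda>k. x k + y k) = walsh n x * walsh n y"
  unfolding walsh_def prod.distrib[symmetric]
proof (rule prod.cong)
  fix k
  show "rademacher k (\<lambda>k. x k + y k) = rademacher k x * rademacher k y"
    by (cases "x k"; cases "y k") (auto simp: rademacher_def)
qed simp

lemma walsh_double: "walsh (2 * n) x = walsh n (\<lambda>k. x (Suc k))"
proof -
  have "{k. bit (2 * n) k} = Suc ` {k. bit n k}"
    by (auto simp: bit_double_iff image_iff gr0_conv_Suc)
  then show ?thesis
    by (simp add: walsh_def prod.reindex rademacher_def)
qed

lemma walsh_double_add_1: "walsh (2 * n + 1) x = rademacher 0 x * walsh n (\<lambda>k. x (Suc k))"
proof -
  have "{k. bit (2 * n + 1) k} = insert 0 (Suc ` {k. bit n k})"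
  proof (rule set_eqI)
    fix k show "k \<in> {k. bit (2 * n + 1) k} \<longleftrightarrow> k \<in> insert 0 (Suc ` {k. bit n k})"
      by (cases k) (auto simp: bit_0 bit_Suc)
  qed
  then show ?thesis
    by (simp add: walsh_def prod.reindex rademacher_def finite_bits_nat)
qed

definition dirichlet_kernel :: "nat \<Rightarrow> dyadic_group \<Rightarrow> real" where
  "dirichlet_kernel n z = (\<Sum>j<n. walsh j z)"

lemma sum_lessThan_double: "(\<Sum>j<2 * n. f j) = (\<Sum>j<n. f (2 * j) + f (2 * j + 1 :: nat))"
  for f :: "nat \<Rightarrow> real"
  by (induction n) auto

text \<open>Induction on the number of binary digits, removing the last digit: for \<open>m = n div 2\<close> and the
  shifted point \<open>z'\<close>, the Walsh functions \<open>w\<^sub>2\<^sub>j\<close> and \<open>w\<^sub>2\<^sub>j\<^sub>+\<^sub>1\<close> are \<open>w\<^sub>j(z')\<close> and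
  \<open>r\<^sub>0 w\<^sub>j(z')\<close>. They cancel in pairs when \<open>z 0 = 1\<close> and double \<open>D\<^sub>m(z')\<close> when \<open>z 0 = 0\<close>, while an
  odd \<open>n\<close> leaves the unpaired term \<open>w\<^sub>m(z')\<close>.\<close>

lemma dirichlet_kernel_eq:
  assumes "n < 2 ^ N"
  shows "dirichlet_kernel n z = walsh n z *
    ((\<Sum>k<N. (of_bool (bit n k) - of_bool (bit n (Suc k))) * 2 ^ Suc k
        * indicator (dyadic_interval (Suc k) (\<lambda>_. 0)) z)
      - of_bool (bit n 0))"
  using assms
proof (induction N arbitrary: n z)
  case 0
  then show ?case by (simp add: dirichlet_kernel_def)
next
  case (Suc N)
  define m where "m = n div 2"
  define z' where "z' = (\<lambda>k. z (Suc k))"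
  define a where "a = (of_bool (z 0 = 0) :: real)"
  define S where "S = (\<Sum>k<N. (of_bool (bit m k) - of_bool (bit m (Suc k))) * 2 ^ Suc k
      * indicator (dyadic_interval (Suc k) (\<lambda>_. 0)) z' :: real)"
  have IH: "dirichlet_kernel m z' = walsh m z' * (S - of_bool (bit m 0))"
    unfolding S_def using Suc.prems by (intro Suc.IH) (simp add: m_def)
  have digit: "bit n (Suc k) = bit m k" for k
    by (simp add: m_def bit_Suc)
  have ind: "indicator (dyadic_interval (Suc k) (\<lambda>_. 0)) z
      = a * indicator (dyadic_interval k (\<lambda>_. 0)) z'" for k
    by (auto simp: indicator_def mem_dyadic_interval z'_def a_def All_less_Suc2)
  have sum_eq: "(\<Sum>k<Suc N. (of_bool (bit n k) - of_bool (bit n (Suc k))) * 2 ^ Suc k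
        * indicator (dyadic_interval (Suc k) (\<lambda>_. 0)) z)
      = 2 * a * (of_bool (bit n 0) - of_bool (bit m 0) + S)"
    unfolding sum.lessThan_Suc_shift digit ind S_def
    by (simp add: sum_distrib_left algebra_simps mem_dyadic_interval)
  have rad: "rademacher 0 z = 2 * a - 1"
    by (cases "z 0") (simp_all add: rademacher_def a_def)
  have even_part: "dirichlet_kernel (2 * m) z = 2 * a * dirichlet_kernel m z'"
    unfolding dirichlet_kernel_def sum_lessThan_double walsh_double walsh_double_add_1 rad z'_def
    by (simp add: sum_distrib_left algebra_simps)
  have a: "a * a = a" by (cases "z 0 = 0") (simp_all add: a_def)
  show ?case
  proof (cases "even n")
    case True
    then have n: "n = 2 * m" by (simp add: m_def)
    have w: "walsh n z = walsh m z'"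
      unfolding n z'_def by (rule walsh_double)
    show ?thesis
      unfolding sum_eq w using True by (simp add: n even_part IH bit_0)
  next
    case False
    then have n: "n = 2 * m + 1" by (simp add: m_def)
    have w: "walsh n z = (2 * a - 1) * walsh m z'"
      unfolding n z'_def walsh_double_add_1 rad by simp
    have "dirichlet_kernel n z = dirichlet_kernel (2 * m) z + walsh m z'"
      unfolding n by (simp add: dirichlet_kernel_def walsh_double z'_def)
    also have "\<dots> = walsh m z' * (2 * a * (S - of_bool (bit m 0)) + 1)"
      unfolding even_part IH by (simp add: algebra_simps)
    \<comment> \<open>Factoring out \<open>2 * a - 1\<close>, the value of \<open>r\<^sub>0\<close> at \<open>z\<close>, uses that its square is 1.\<close>
    also have "2 * a * (S - of_bool (bit m 0)) + 1
        = (2 * a - 1) * (2 * a * (1 - of_bool (bit m 0) + S) - 1)"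
      using a by (auto simp: a_def)
    finally show ?thesis
      unfolding sum_eq w using False by (simp add: bit_0)
  qed
qed

lemma variation_eq:
  assumes "n < 2 ^ N"
  shows "variation n = of_bool (bit n 0) +
    (\<Sum>k<N. \<bar>of_bool (bit n (Suc k)) - of_bool (bit n k)\<bar>)"
proof -
  have "(\<Sum>k. \<bar>of_bool (bit n (Suc k)) - of_bool (bit n k) :: real\<bar>)
      = (\<Sum>k<N. \<bar>of_bool (bit n (Suc k)) - of_bool (bit n k)\<bar>)"
  proof (rule suminf_finite)
    fix k assume "k \<notin> {..<N}"
    then have "\<not> bit n k" "\<not> bit n (Suc k)"
      using bit_nat_imp_less[OF assms] by (meson lessThan_iff Suc_lessD)+
    then show "\<bar>of_bool (bit n (Suc k)) - of_bool (bit n k) :: real\<bar> = 0" by simp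
  qed simp
  then show ?thesis by (simp add: variation_def)
qed

lemma abs_dirichlet_kernel_le:
  assumes "n < 2 ^ N"
  shows "\<bar>dirichlet_kernel n z\<bar> \<le> of_bool (bit n 0) +
    (\<Sum>k<N. \<bar>of_bool (bit n (Suc k)) - of_bool (bit n k)\<bar> *
      (2 ^ Suc k * indicator (dyadic_interval (Suc k) (\<lambda>_. 0)) z))"
proof -
  let ?S = "\<Sum>k<N. (of_bool (bit n k) - of_bool (bit n (Suc k))) * 2 ^ Suc k
        * indicator (dyadic_interval (Suc k) (\<lambda>_. 0)) z :: real"
  have "\<bar>dirichlet_kernel n z\<bar> = \<bar>?S - of_bool (bit n 0)\<bar>"
    unfolding dirichlet_kernel_eq[OF assms] abs_mult using walsh_cases[of n z] by auto
  also have "\<dots> \<le> of_bool (bit n 0) + \<bar>?S\<bar>"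
    by auto
  also have "\<bar>?S\<bar> \<le> (\<Sum>k<N. \<bar>(of_bool (bit n k) - of_bool (bit n (Suc k))) * 2 ^ Suc k
        * indicator (dyadic_interval (Suc k) (\<lambda>_. 0)) z\<bar>)"
    by (rule sum_abs)
  also have "\<dots> = (\<Sum>k<N. \<bar>of_bool (bit n (Suc k)) - of_bool (bit n k)\<bar> *
      (2 ^ Suc k * indicator (dyadic_interval (Suc k) (\<lambda>_. 0)) z))"
    by (intro sum.cong refl) (simp add: abs_mult abs_minus_commute)
  finally show ?thesis by simp
qed

lemma walsh_zero: "walsh n (\<lambda>_. 0) = 1"
  by (simp add: walsh_def rademacher_def)

text \<open>All Walsh functions are 1 at the point 0, so \<open>D\<^sub>n(0) = n\<close>, whereas the kernel bound at 0 is at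
  most \<open>2\<^sup>n\<close> times the variation.\<close>

lemma variation_pos:
  assumes "n \<ge> 1"
  shows "variation n > 0"
proof -
  have less: "n < 2 ^ n" by simp
  let ?v = "\<lambda>k. \<bar>of_bool (bit n (Suc k)) - of_bool (bit n k) :: real\<bar>"
  have "real n = \<bar>dirichlet_kernel n (\<lambda>_. 0)\<bar>"
    by (simp add: dirichlet_kernel_def walsh_zero)
  also have "\<dots> \<le> of_bool (bit n 0) +
      (\<Sum>k<n. ?v k * (2 ^ Suc k * indicator (dyadic_interval (Suc k) (\<lambda>_. 0)) (\<lambda>_. 0)))"
    by (rule abs_dirichlet_kernel_le[OF less])
  also have "\<dots> \<le> of_bool (bit n 0) * 2 ^ n + (\<Sum>k<n. ?v k * 2 ^ n)"
  proof (intro add_mono sum_mono mult_left_mono)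
    fix k assume "k \<in> {..<n}"
    then have "(2::real) ^ Suc k \<le> 2 ^ n"
      by (intro power_increasing) auto
    then show "2 ^ Suc k * indicator (dyadic_interval (Suc k) (\<lambda>_. 0)) (\<lambda>_. 0) \<le> (2::real) ^ n"
      by (simp add: mem_dyadic_interval)
  qed auto
  also have "\<dots> = 2 ^ n * variation n"
    by (simp add: variation_eq[OF less] sum_distrib_left algebra_simps)
  finally have "2 ^ n * variation n > 0" using assms by linarith
  then show ?thesis by (simp add: zero_less_mult_iff)
qed

section \<open>Partial sums of martingales\<close>

text \<open>The integrals in the definition of the coefficient are constant from \<open>N\<close> on: \<open>w\<^sub>k\<close> depends on
  the first \<open>N\<close> coordinates only and takes the values 1 and -1, so they are combinations of the
  integrals of \<open>F\<^sub>n\<close> over \<open>{w\<^sub>k = 1}\<close> and over the whole group, which the martingale property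
  fixes.\<close>

lemma walsh_coeff_martingale:
  fixes F :: "nat \<Rightarrow> dyadic_group \<Rightarrow> 'a::{real_normed_field,banach,second_countable_topology}"
  assumes F: "dyadic_martingale F" and k: "k < 2 ^ N"
  shows "walsh_coeff F k = (LINT x|haar. walsh k x *\<^sub>R F N x)"
proof -
  define A where "A = {x. walsh k x = 1}"
  have A: "A \<in> sets (dyadic_algebra N)"
    unfolding sets_dyadic_algebra_iff A_def using walsh_cong[OF k] by auto
  then have A': "A \<in> sets haar" using sets_dyadic_algebra_subset by blast
  have int: "integrable haar (F n)" for n
    using F by (simp add: dyadic_martingale_def)
  have eq: "(LINT x|haar. walsh k x *\<^sub>R F n x)
      = 2 *\<^sub>R set_lebesgue_integral haar A (F n) - set_lebesgue_integral haar UNIV (F n)" for n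
  proof -
    have "walsh k x *\<^sub>R F n x = 2 *\<^sub>R (indicator A x *\<^sub>R F n x) - F n x" for x
      using walsh_cases[of k x] by (auto simp: A_def scaleR_2)
    then have "(LINT x|haar. walsh k x *\<^sub>R F n x)
        = (LINT x|haar. 2 *\<^sub>R (indicator A x *\<^sub>R F n x) - F n x)"
      by (simp only:)
    also have "\<dots> = (LINT x|haar. 2 *\<^sub>R (indicator A x *\<^sub>R F n x)) - (LINT x|haar. F n x)"
      by (intro Bochner_Integration.integral_diff integrable_scaleR_right
          integrable_mult_indicator A' int)
    finally show ?thesis
      by (simp only: integral_scaleR_right set_lebesgue_integral_def indicator_UNIV scaleR_one)
  qed
  have UNIV: "UNIV \<in> sets (dyadic_algebra N)"
    unfolding sets_dyadic_algebra_iff by simp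
  have "(LINT x|haar. walsh k x *\<^sub>R F n x) = (LINT x|haar. walsh k x *\<^sub>R F N x)" if "n \<ge> N" for n
    using F A UNIV that unfolding eq dyadic_martingale_def by metis
  then have "(\<lambda>n. LINT x|haar. walsh k x *\<^sub>R F n x)
      \<longlonglongrightarrow> (LINT x|haar. walsh k x *\<^sub>R F N x)"
    by (intro tendsto_eventually eventually_sequentiallyI)
  then show ?thesis
    unfolding walsh_coeff_def by (rule limI)
qed

lemma measurable_dirichlet_kernel [measurable]: "dirichlet_kernel n \<in> borel_measurable haar"
  unfolding dirichlet_kernel_def[abs_def] by measurable

lemma walsh_partial_sum_eq_convolution:
  fixes F :: "nat \<Rightarrow> dyadic_group \<Rightarrow> 'a::{real_normed_field,banach,second_countable_topology}"
  assumes F: "dyadic_martingale F" and n: "n < 2 ^ N"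
  shows "walsh_partial_sum n F x = (LINT t|haar. dirichlet_kernel n (\<lambda>k. x k + t k) *\<^sub>R F N t)"
proof -
  have int: "integrable haar (F N)"
    using F by (simp add: dyadic_martingale_def)
  then have [measurable]: "F N \<in> borel_measurable haar" by auto
  have int': "integrable haar (\<lambda>t. walsh j t *\<^sub>R F N t)" for j
  proof (rule Bochner_Integration.integrable_bound[OF int])
    show "AE t in haar. norm (walsh j t *\<^sub>R F N t) \<le> norm (F N t)"
      using walsh_cases[of j] by (intro AE_I2) (metis abs_minus_cancel abs_one mult_1 norm_scaleR order_refl)
  qed measurable
  have "walsh_partial_sum n F x = (\<Sum>j<n. walsh j x *\<^sub>R (LINT t|haar. walsh j t *\<^sub>R F N t))"
    unfolding walsh_partial_sum_def
    by (intro sum.cong refl) (use n in \<open>simp add: walsh_coeff_martingale[OF F, of _ N]\<close>)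
  also have "\<dots> = (LINT t|haar. (\<Sum>j<n. walsh j x *\<^sub>R walsh j t *\<^sub>R F N t))"
    by (subst Bochner_Integration.integral_sum)
      (auto intro!: integrable_scaleR_right int' simp del: scaleR_scaleR)
  also have "\<dots> = (LINT t|haar. dirichlet_kernel n (\<lambda>k. x k + t k) *\<^sub>R F N t)"
    unfolding dirichlet_kernel_def walsh_add scaleR_sum_left by simp
  finally show ?thesis .
qed

lemma measurable_maximal_function:
  fixes F :: "nat \<Rightarrow> dyadic_group \<Rightarrow> 'a::{real_normed_field,banach,second_countable_topology}"
  assumes "dyadic_martingale F"
  shows "maximal_function F \<in> borel_measurable haar"
proof -
  have [measurable]: "F n \<in> borel_measurable haar" for n
    using assms unfolding dyadic_martingale_def by (blast intro: borel_measurable_integrable)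
  show ?thesis unfolding maximal_function_def[abs_def] by measurable
qed

lemma bit_add_eq_0_iff: "a + b = 0 \<longleftrightarrow> b = a" for a b :: bit
  by (cases a; cases b) simp_all

text \<open>After translation by \<open>x\<close>, the kernel bound is a combination of averages over the intervals
  around \<open>x\<close>. Its total weight is the variation of \<open>n\<close>, and each average is at most the dyadic
  maximal function.\<close>

lemma nn_integral_dirichlet_kernel_le:
  assumes [measurable]: "g \<in> borel_measurable haar"
  shows "(\<integral>\<^sup>+ t. ennreal \<bar>dirichlet_kernel n (\<lambda>k. x k + t k)\<bar> * g t \<partial>haar)
    \<le> ennreal (variation n) * dyadic_maximal g x"
proof -
  have less: "n < 2 ^ n" by simp
  define c where "c k = \<bar>of_bool (bit n (Suc k)) - of_bool (bit n k) :: real\<bar>" for k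
  let ?b = "of_bool (bit n 0) :: real"
  let ?I = "\<lambda>k. dyadic_interval (Suc k) x"
  have c: "c k \<ge> 0" for k by (simp add: c_def)
  have maximal: "2 ^ k * (\<integral>\<^sup>+ t \<in> dyadic_interval k x. g t \<partial>haar) \<le> dyadic_maximal g x" for k
    unfolding dyadic_maximal_def by (rule SUP_upper) simp
  have ind: "indicator (dyadic_interval k (\<lambda>_. 0)) (\<lambda>k. x k + t k)
      = (indicator (dyadic_interval k x) t :: real)" for k t
    by (simp only: indicator_def mem_dyadic_interval bit_add_eq_0_iff)
  have "(\<integral>\<^sup>+ t. ennreal \<bar>dirichlet_kernel n (\<lambda>k. x k + t k)\<bar> * g t \<partial>haar)
      \<le> (\<integral>\<^sup>+ t. ennreal (?b + (\<Sum>k<n. c k * (2 ^ Suc k * indicator (?I k) t))) * g t \<partial>haar)"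
  proof (intro nn_integral_mono mult_right_mono ennreal_leI)
    fix t
    show "\<bar>dirichlet_kernel n (\<lambda>k. x k + t k)\<bar>
        \<le> ?b + (\<Sum>k<n. c k * (2 ^ Suc k * indicator (?I k) t))"
      using abs_dirichlet_kernel_le[OF less, of "\<lambda>k. x k + t k"] unfolding ind c_def .
  qed simp
  also have "\<dots> = (\<integral>\<^sup>+ t. ennreal ?b * g t
      + (\<Sum>k<n. ennreal (c k * 2 ^ Suc k) * (g t * indicator (?I k) t)) \<partial>haar)"
  proof (intro nn_integral_cong)
    fix t
    have "ennreal (?b + (\<Sum>k<n. c k * (2 ^ Suc k * indicator (?I k) t)))
        = ennreal ?b + (\<Sum>k<n. ennreal (c k * (2 ^ Suc k * indicator (?I k) t)))"
      by (subst ennreal_plus) (auto intro!: sum_nonneg simp: c)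
    also have "(\<Sum>k<n. ennreal (c k * (2 ^ Suc k * indicator (?I k) t)))
        = (\<Sum>k<n. ennreal (c k * 2 ^ Suc k) * indicator (?I k) t)"
      by (intro sum.cong refl) (auto simp: indicator_def)
    finally have *: "ennreal (?b + (\<Sum>k<n. c k * (2 ^ Suc k * indicator (?I k) t)))
        = ennreal ?b + (\<Sum>k<n. ennreal (c k * 2 ^ Suc k) * indicator (?I k) t)" .
    show "ennreal (?b + (\<Sum>k<n. c k * (2 ^ Suc k * indicator (?I k) t))) * g t
        = ennreal ?b * g t + (\<Sum>k<n. ennreal (c k * 2 ^ Suc k) * (g t * indicator (?I k) t))"
      unfolding * distrib_right sum_distrib_right by (simp only: ac_simps)
  qed
  also have "\<dots> = ennreal ?b * (\<integral>\<^sup>+ t. g t \<partial>haar)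
      + (\<Sum>k<n. ennreal (c k * 2 ^ Suc k) * (\<integral>\<^sup>+ t \<in> ?I k. g t \<partial>haar))"
    by (simp add: nn_integral_add nn_integral_sum nn_integral_cmult)
  also have "\<dots> = ennreal ?b * (2 ^ 0 * (\<integral>\<^sup>+ t \<in> dyadic_interval 0 x. g t \<partial>haar))
      + (\<Sum>k<n. ennreal (c k) * (2 ^ Suc k * (\<integral>\<^sup>+ t \<in> ?I k. g t \<partial>haar)))"
    \<comment> \<open>The integral over the whole group is the average over the interval of rank 0.\<close>
  proof -
    have "ennreal (c k * 2 ^ Suc k) = ennreal (c k) * 2 ^ Suc k" for k
      by (subst ennreal_mult) (auto simp: c ennreal_mult ennreal_power[symmetric])
    then show ?thesis
      by (simp add: dyadic_interval_def mult.assoc)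
  qed
  also have "\<dots> \<le> ennreal ?b * dyadic_maximal g x + (\<Sum>k<n. ennreal (c k) * dyadic_maximal g x)"
    by (intro add_mono sum_mono mult_left_mono maximal) auto
  also have "\<dots> = ennreal (variation n) * dyadic_maximal g x"
  proof -
    have "ennreal (variation n) = ennreal ?b + ennreal (\<Sum>k<n. c k)"
      unfolding variation_eq[OF less] c_def[symmetric]
      by (rule ennreal_plus) (simp_all add: c sum_nonneg)
    also have "ennreal (\<Sum>k<n. c k) = (\<Sum>k<n. ennreal (c k))"
      using c by (intro sum_ennreal[symmetric]) simp
    finally show ?thesis
      by (simp only: distrib_right sum_distrib_right)
  qed
  finally show ?thesis .
qed

lemma weighted_maximal_le_dyadic_maximal:
  fixes F :: "nat \<Rightarrow> dyadic_group \<Rightarrow> 'a::{real_normed_field,banach,second_countable_topology}"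
  assumes F: "dyadic_martingale F"
  shows "weighted_maximal F x \<le> dyadic_maximal (maximal_function F) x"
  unfolding weighted_maximal_def
proof (rule SUP_least)
  fix n :: nat assume "n \<in> {1..}"
  then have pos: "variation n > 0" by (simp add: variation_pos)
  let ?K = "\<lambda>t. dirichlet_kernel n (\<lambda>k. x k + t k)"
  let ?M = "dyadic_maximal (maximal_function F) x"
  have less: "n < 2 ^ n" by simp
  have "ennreal (norm (walsh_partial_sum n F x)) \<le> (\<integral>\<^sup>+ t. ennreal (norm (?K t *\<^sub>R F n t)) \<partial>haar)"
  proof (cases "integrable haar (\<lambda>t. ?K t *\<^sub>R F n t)")
    case True
    then show ?thesis
      unfolding walsh_partial_sum_eq_convolution[OF F less] by (rule integral_norm_bound_ennreal)
  next
    case False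
    then have "walsh_partial_sum n F x = 0"
      unfolding walsh_partial_sum_eq_convolution[OF F less] by (rule not_integrable_integral_eq)
    then show ?thesis by simp
  qed
  also have "\<dots> \<le> (\<integral>\<^sup>+ t. ennreal \<bar>?K t\<bar> * maximal_function F t \<partial>haar)"
    unfolding maximal_function_def
    by (intro nn_integral_mono) (auto simp: ennreal_mult intro!: mult_left_mono SUP_upper)
  also have "\<dots> \<le> ennreal (variation n) * ?M"
    by (rule nn_integral_dirichlet_kernel_le) (rule measurable_maximal_function[OF F])
  finally have le: "ennreal (norm (walsh_partial_sum n F x)) \<le> ennreal (variation n) * ?M" .
  show "ennreal (norm (walsh_partial_sum n F x) / variation n) \<le> ?M"
  proof (cases ?M)
    case (real r)
    with le pos have "norm (walsh_partial_sum n F x) \<le> variation n * r"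
      by (simp add: ennreal_mult[symmetric])
    with real pos show ?thesis by (simp add: field_simps)
  qed simp
qed

lemma weak_L1_norm_weighted_maximal_le:
  fixes F :: "nat \<Rightarrow> dyadic_group \<Rightarrow> 'a::{real_normed_field,banach,second_countable_topology}"
  assumes F: "dyadic_martingale F"
  shows "weak_L1_norm (weighted_maximal F) \<le> H1_norm F"
  unfolding weak_L1_norm_def
proof (rule SUP_least)
  fix t :: real assume "t \<in> {0<..}"
  note [measurable] = measurable_maximal_function[OF F]
  let ?M = "dyadic_maximal (maximal_function F)"
  have "ennreal t * emeasure haar {x \<in> space haar. weighted_maximal F x > ennreal t}
      \<le> ennreal t * emeasure haar {x. ?M x > ennreal t}"
    by (intro mult_left_mono emeasure_mono sets_dyadic_maximal_greater)
      (auto intro: less_le_trans weighted_maximal_le_dyadic_maximal[OF F])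
  also have "\<dots> \<le> H1_norm F"
    unfolding H1_norm_def L1_norm_def by (rule dyadic_maximal_weak_type) measurable
  finally show "ennreal t * emeasure haar {x \<in> space haar. weighted_maximal F x > ennreal t}
      \<le> H1_norm F" .
qed

section \<open>Dyadic atoms\<close>

text \<open>This is \<open>r\<^sub>m D\<^bsub>2^m\<^esub>\<close>, since \<open>D\<^bsub>2^m\<^esub> = 2\<^sup>m 1\<^bsub>I\<^sub>m(0)\<^esub>\<close>.\<close>

definition dyadic_atom :: "nat \<Rightarrow> dyadic_group \<Rightarrow> real" where
  "dyadic_atom m x = 2 ^ m * rademacher m x * indicator (dyadic_interval m (\<lambda>_. 0)) x"

text \<open>The conditional expectations of the atom: on an interval of rank \<open>n \<le> m\<close> its mean is 0, and
  from rank \<open>m + 1\<close> on it is measurable. The factor \<open>1\<close> embeds the reals into the scalar field.\<close>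

definition atom_martingale :: "nat \<Rightarrow> nat \<Rightarrow> dyadic_group \<Rightarrow> 'a::real_normed_field" where
  "atom_martingale m n x = (if n \<le> m then 0 else dyadic_atom m x *\<^sub>R 1)"

text \<open>The rank \<open>m + 1\<close> halves of \<open>I\<^sub>m(0)\<close> carry opposite values, hence the integral below is 0.\<close>

lemma dyadic_atom_eq:
  "dyadic_atom m x = 2 ^ m * indicator (dyadic_interval (Suc m) (\<lambda>_. 0)) x
    - 2 ^ m * indicator (dyadic_interval (Suc m) (\<lambda>i. of_bool (i = m))) x"
  by (cases "x m") (auto simp: dyadic_atom_def rademacher_def indicator_def mem_dyadic_interval less_Suc_eq)

lemma
  shows integrable_dyadic_atom: "integrable haar (dyadic_atom m)"
    and integral_dyadic_atom: "(LINT x|haar. dyadic_atom m x) = 0"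
proof -
  interpret prob_space haar by (rule prob_space_haar)
  have int: "integrable haar (\<lambda>x. 2 ^ m * indicator (dyadic_interval (Suc m) y) x :: real)" for y
    by (intro integrable_mult_right integrable_real_indicator)
      (auto simp: emeasure_dyadic_interval)
  show "integrable haar (dyadic_atom m)"
    unfolding dyadic_atom_eq[abs_def] by (intro Bochner_Integration.integrable_diff int)
  show "(LINT x|haar. dyadic_atom m x) = 0"
    unfolding dyadic_atom_eq
    by (subst Bochner_Integration.integral_diff[OF int int]) (simp add: measure_dyadic_interval)
qed

lemma dyadic_martingale_atom:
  "dyadic_martingale (atom_martingale m ::
    nat \<Rightarrow> dyadic_group \<Rightarrow> 'a::{real_normed_field,banach,second_countable_topology})"
  unfolding dyadic_martingale_def
proof (intro conjI allI impI ballI)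
  fix n
  show "(atom_martingale m n :: dyadic_group \<Rightarrow> 'a) \<in> borel_measurable (dyadic_algebra n)"
  proof (rule measurable_dyadic_algebra)
    fix x y assume y: "y \<in> dyadic_interval n x"
    show "(atom_martingale m n y :: 'a) = atom_martingale m n x"
    proof (cases "n \<le> m")
      case False
      with y have "y k = x k" if "k \<le> m" for k
        using that by (simp add: mem_dyadic_interval)
      then show ?thesis
        by (simp add: atom_martingale_def dyadic_atom_def rademacher_def indicator_def
            mem_dyadic_interval)
    qed (simp add: atom_martingale_def)
  qed
  show "integrable haar (atom_martingale m n :: dyadic_group \<Rightarrow> 'a)"
    unfolding atom_martingale_def[abs_def]
    by (cases "n \<le> m") (auto intro: integrable_scaleR_left integrable_dyadic_atom)
next
  fix p q A assume pq: "p \<le> q" and A: "A \<in> sets (dyadic_algebra p)"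
  \<comment> \<open>When \<open>p \<le> m\<close>, the set \<open>A\<close> contains the support \<open>I\<^sub>m(0)\<close> of the atom or is disjoint from it.\<close>
  show "set_lebesgue_integral haar A (atom_martingale m q :: dyadic_group \<Rightarrow> 'a)
      = set_lebesgue_integral haar A (atom_martingale m p)"
  proof (cases "p \<le> m \<and> m < q")
    case False
    then have "p \<le> m \<longleftrightarrow> q \<le> m" using pq by auto
    then show ?thesis by (simp add: atom_martingale_def set_lebesgue_integral_def)
  next
    case True
    have prefix: "x \<in> A \<longleftrightarrow> (\<lambda>_. 0) \<in> A" if "x \<in> dyadic_interval m (\<lambda>_. 0)" for x
    proof -
      have "x \<in> dyadic_interval p (\<lambda>_. 0)"
        using that True by (auto simp: mem_dyadic_interval)
      moreover from this have "(\<lambda>_. 0) \<in> dyadic_interval p x"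
        by (simp add: mem_dyadic_interval)
      ultimately show ?thesis
        using A unfolding sets_dyadic_algebra_iff by blast
    qed
    have "indicator A x *\<^sub>R (atom_martingale m q x :: 'a)
        = dyadic_atom m x *\<^sub>R of_bool ((\<lambda>_. 0) \<in> A)" for x
      using True prefix[of x] by (auto simp: atom_martingale_def dyadic_atom_def indicator_def)
    then have "set_lebesgue_integral haar A (atom_martingale m q :: dyadic_group \<Rightarrow> 'a) = 0"
      unfolding set_lebesgue_integral_def by (simp add: integral_dyadic_atom integrable_dyadic_atom)
    moreover have "set_lebesgue_integral haar A (atom_martingale m p :: dyadic_group \<Rightarrow> 'a) = 0"
      using True by (simp add: atom_martingale_def set_lebesgue_integral_def)
    ultimately show ?thesis by simp
  qed
qed

lemma H1_norm_atom_le: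
  "H1_norm (atom_martingale m :: nat \<Rightarrow> dyadic_group \<Rightarrow> 'a::real_normed_field) \<le> 1"
proof -
  have "H1_norm (atom_martingale m :: nat \<Rightarrow> dyadic_group \<Rightarrow> 'a)
      \<le> (\<integral>\<^sup>+ x. ennreal (2 ^ m) * indicator (dyadic_interval m (\<lambda>_. 0)) x \<partial>haar)"
    unfolding H1_norm_def L1_norm_def maximal_function_def
    by (intro nn_integral_mono SUP_least)
      (auto simp: atom_martingale_def dyadic_atom_def rademacher_def indicator_def abs_mult)
  also have "\<dots> = 1"
    by (simp add: nn_integral_cmult_indicator emeasure_dyadic_interval ennreal_mult[symmetric])
  finally show ?thesis .
qed

lemma walsh_eq_1:
  assumes "j < 2 ^ k" "x \<in> dyadic_interval k (\<lambda>_. 0)"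
  shows "walsh j x = 1"
  using walsh_cong[OF assms] walsh_zero by simp

lemma bits_exp_add:
  assumes "j < 2 ^ m"
  shows "{i. bit (2 ^ m + j :: nat) i} = insert m {i. bit j i}"
proof -
  have "\<not> bit (2 ^ m :: nat) i \<or> \<not> bit j i" for i
    using bit_nat_imp_less[OF assms, of i] by (auto simp: bit_exp_iff)
  then have "bit (2 ^ m + j) i \<longleftrightarrow> bit (2 ^ m :: nat) i \<or> bit j i" for i
    by (rule bit_disjunctive_add_iff)
  then show ?thesis by (auto simp: bit_exp_iff)
qed

lemma walsh_exp_add:
  assumes "j < 2 ^ m"
  shows "walsh (2 ^ m + j) x = rademacher m x * walsh j x"
  using bit_nat_imp_less[OF assms]
  unfolding walsh_def bits_exp_add[OF assms] by (subst prod.insert) (auto simp: finite_bits_nat)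

text \<open>On the support \<open>I\<^sub>m(0)\<close> of the atom, \<open>w\<^sub>j = 1\<close> and \<open>w\<^bsub>2^m + j\<^esub> = r\<^sub>m\<close>. So the two integrands are the
  atom, with integral 0, and its absolute value, with integral 1.\<close>

lemma walsh_coeff_atom:
  assumes j: "j < 2 ^ m"
  shows "walsh_coeff (atom_martingale m ::
      nat \<Rightarrow> dyadic_group \<Rightarrow> 'a::{real_normed_field,banach,second_countable_topology}) j = 0"
    and "walsh_coeff (atom_martingale m :: nat \<Rightarrow> dyadic_group \<Rightarrow> 'a) (2 ^ m + j) = 1"
proof -
  let ?F = "atom_martingale m :: nat \<Rightarrow> dyadic_group \<Rightarrow> 'a"
  have coeff: "walsh_coeff ?F k = (LINT x|haar. (walsh k x * dyadic_atom m x) *\<^sub>R 1)"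
    if "k < 2 ^ Suc m" for k
    unfolding walsh_coeff_martingale[OF dyadic_martingale_atom that] atom_martingale_def by simp
  have low: "walsh j x * dyadic_atom m x = dyadic_atom m x" for x
    using walsh_eq_1[OF j, of x] by (simp add: dyadic_atom_def indicator_def)
  have "walsh_coeff ?F j = (LINT x|haar. dyadic_atom m x *\<^sub>R 1)"
    using coeff[of j] j by (simp only: low) simp
  then show "walsh_coeff ?F j = 0"
    by (simp add: integrable_dyadic_atom integral_dyadic_atom)
  have high: "walsh (2 ^ m + j) x * dyadic_atom m x
      = 2 ^ m * indicator (dyadic_interval m (\<lambda>_. 0)) x" for x
    using walsh_eq_1[OF j, of x]
    by (simp add: walsh_exp_add[OF j] dyadic_atom_def indicator_def rademacher_def)
  have "integrable haar (\<lambda>x. 2 ^ m * indicator (dyadic_interval m (\<lambda>_. 0)) x :: real)"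
    by (intro integrable_mult_right integrable_real_indicator) (auto simp: emeasure_dyadic_interval)
  moreover have "walsh_coeff ?F (2 ^ m + j)
      = (LINT x|haar. (2 ^ m * indicator (dyadic_interval m (\<lambda>_. 0)) x) *\<^sub>R 1)"
    using coeff[of "2 ^ m + j"] j by (simp only: high) simp
  ultimately show "walsh_coeff ?F (2 ^ m + j) = 1"
    by (simp add: measure_dyadic_interval del: scaleR_scaleR)
qed

lemma sum_lessThan_add: "(\<Sum>j<a + b. f j) = (\<Sum>j<a. f j) + (\<Sum>j<b. f (a + j))"
  for f :: "nat \<Rightarrow> 'a::comm_monoid_add"
  by (induction b) (auto simp: add.assoc)

lemma norm_walsh_partial_sum_atom:
  assumes "k < m" "x \<in> dyadic_interval k (\<lambda>_. 0)"
  shows "norm (walsh_partial_sum (2 ^ m + 2 ^ k) (atom_martingale m ::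
      nat \<Rightarrow> dyadic_group \<Rightarrow> 'a::{real_normed_field,banach,second_countable_topology}) x) = 2 ^ k"
proof -
  let ?F = "atom_martingale m :: nat \<Rightarrow> dyadic_group \<Rightarrow> 'a"
  have less: "j < 2 ^ m" if "j < 2 ^ k" for j :: nat
    using that assms(1) by (meson less_le_trans less_imp_le one_le_numeral power_increasing)
  have "walsh_partial_sum (2 ^ m + 2 ^ k) ?F x = (\<Sum>j<(2::nat) ^ k. rademacher m x *\<^sub>R 1)"
    unfolding walsh_partial_sum_def sum_lessThan_add
    by (simp add: walsh_coeff_atom less walsh_exp_add walsh_eq_1[OF _ assms(2)])
  then show ?thesis
    by (simp add: rademacher_def norm_mult norm_power)
qed

text \<open>Each digit enters two terms of the variation, and each term is at most the sum of its digits.\<close>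

lemma variation_le_card_bits: "variation n \<le> 2 * real (card {k. bit n k})"
proof -
  have less: "n < 2 ^ n" by simp
  let ?b = "\<lambda>k. of_bool (bit n k) :: real"
  have card: "(\<Sum>k<N. ?b k) \<le> real (card {k. bit n k})" for N
    by (subst sum_of_bool_eq) (auto intro!: card_mono finite_bits_nat)
  have "variation n \<le> ?b 0 + (\<Sum>k<n. ?b (Suc k) + ?b k)"
    unfolding variation_eq[OF less] by (intro add_left_mono sum_mono) auto
  also have "\<dots> = (\<Sum>k<Suc n. ?b k) + (\<Sum>k<n. ?b k)"
    unfolding sum.lessThan_Suc_shift sum.distrib by simp
  also have "\<dots> \<le> 2 * real (card {k. bit n k})"
    using card[of "Suc n"] card[of n] by linarith
  finally show ?thesis .
qed

lemma weighted_maximal_atom_ge: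
  assumes "k < m" "x \<in> dyadic_interval k (\<lambda>_. 0)"
  shows "ennreal (2 ^ k / 4) \<le> weighted_maximal (atom_martingale m ::
      nat \<Rightarrow> dyadic_group \<Rightarrow> 'a::{real_normed_field,banach,second_countable_topology}) x"
proof -
  let ?F = "atom_martingale m :: nat \<Rightarrow> dyadic_group \<Rightarrow> 'a"
  let ?n = "2 ^ m + 2 ^ k :: nat"
  have n: "?n \<ge> 1" by (simp add: Suc_le_eq)
  have "(2::nat) ^ k < 2 ^ m" using assms(1) by simp
  then have "{i. bit ?n i} = insert m {k}"
    by (subst bits_exp_add) (auto simp: bit_exp_iff)
  then have "card {i. bit ?n i} = 2" using assms(1) by simp
  with variation_le_card_bits[of ?n] have "variation ?n \<le> 4" by simp
  moreover have "variation ?n > 0" by (rule variation_pos[OF n])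
  ultimately have "ennreal (2 ^ k / 4)
      \<le> ennreal (norm (walsh_partial_sum ?n ?F x) / variation ?n)"
    unfolding norm_walsh_partial_sum_atom[OF assms] by (intro ennreal_leI divide_left_mono) auto
  also have "\<dots> \<le> weighted_maximal ?F x"
    unfolding weighted_maximal_def by (rule SUP_upper) (use n in simp)
  finally show ?thesis .
qed

text \<open>The sets \<open>I\<^sub>k(0) - I\<^sub>k\<^sub>+\<^sub>1(0)\<close> for \<open>k < m\<close> are disjoint, and on each of them the bound
  \<open>2\<^sup>k / 4\<close> contributes \<open>2\<^sup>k / 4 \<cdot> 2\<^sup>-\<^sup>k\<^sup>-\<^sup>1 = 1/8\<close> to the integral. Each is itself the interval
  of rank \<open>k + 1\<close> around the point whose only nonzero coordinate is the one with index \<open>k\<close>.\<close>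

lemma L1_norm_weighted_maximal_atom_ge:
  "ennreal (real m / 8) \<le> L1_norm (weighted_maximal (atom_martingale m ::
      nat \<Rightarrow> dyadic_group \<Rightarrow> 'a::{real_normed_field,banach,second_countable_topology}))"
proof -
  let ?F = "atom_martingale m :: nat \<Rightarrow> dyadic_group \<Rightarrow> 'a"
  let ?I = "\<lambda>k. dyadic_interval (Suc k) (\<lambda>i. of_bool (i = k))"
  have digit: "x i = of_bool (i = k)" if "x \<in> ?I k" "i \<le> k" for x i k
    using that by (simp add: mem_dyadic_interval)
  have unique: "i = k" if "x \<in> ?I k" "x \<in> ?I i" for x i k
    using digit[OF that(1), of i] digit[OF that(1), of k] digit[OF that(2), of i]
      digit[OF that(2), of k] by (cases i k rule: linorder_cases) auto
  have pointwise: "(\<Sum>k<m. ennreal (2 ^ k / 4) * indicator (?I k) x) \<le> weighted_maximal ?F x" for x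
  proof (cases "\<exists>k<m. x \<in> ?I k")
    case True
    then obtain k where k: "k < m" "x \<in> ?I k" by blast
    have "x \<in> ?I i \<longleftrightarrow> i = k" for i
      using unique[OF k(2), of i] k(2) by blast
    then have "(\<Sum>i<m. ennreal (2 ^ i / 4) * indicator (?I i) x)
        = (\<Sum>i<m. if i = k then ennreal (2 ^ k / 4) else 0)"
      by (intro sum.cong refl) (simp add: indicator_def)
    also have "\<dots> = ennreal (2 ^ k / 4)"
      using k(1) by simp
    also have "\<dots> \<le> weighted_maximal ?F x"
      by (rule weighted_maximal_atom_ge[OF k(1)]) (use k(2) in \<open>auto simp: mem_dyadic_interval\<close>)
    finally show ?thesis .
  next
    case False
    then have "(\<Sum>k<m. ennreal (2 ^ k / 4) * indicator (?I k) x) = 0"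
      by (intro sum.neutral) (auto simp: indicator_def)
    then show ?thesis by simp
  qed
  have "ennreal (real m / 8) = (\<Sum>k<m. ennreal (1 / 8))"
    by (subst sum_ennreal) auto
  also have "\<dots> = (\<Sum>k<m. ennreal (2 ^ k / 4) * emeasure haar (?I k))"
    by (intro sum.cong refl) (simp add: emeasure_dyadic_interval ennreal_mult[symmetric])
  also have "\<dots> = (\<integral>\<^sup>+ x. (\<Sum>k<m. ennreal (2 ^ k / 4) * indicator (?I k) x) \<partial>haar)"
    by (subst nn_integral_sum) (simp_all add: nn_integral_cmult_indicator)
  also have "\<dots> \<le> L1_norm (weighted_maximal ?F)"
    unfolding L1_norm_def by (intro nn_integral_mono pointwise)
  finally show ?thesis .
qed

theorem theorem1:
  shows "(\<exists>C::real. C > 0 \<and>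
            (\<forall>F \<in> (hardy_H1 :: (nat \<Rightarrow> dyadic_group \<Rightarrow>
                        'a::{real_normed_field,banach,second_countable_topology}) set).
               weak_L1_norm (weighted_maximal F) \<le> ennreal C * H1_norm F)) \<and>
         \<not> (\<exists>C::real. C > 0 \<and>
            (\<forall>F \<in> (hardy_H1 :: (nat \<Rightarrow> dyadic_group \<Rightarrow> 'a) set).
               L1_norm (weighted_maximal F) \<le> ennreal C * H1_norm F))"
proof (intro conjI notI)
  show "\<exists>C::real. C > 0 \<and> (\<forall>F \<in> (hardy_H1 :: (nat \<Rightarrow> dyadic_group \<Rightarrow> 'a) set).
      weak_L1_norm (weighted_maximal F) \<le> ennreal C * H1_norm F)"
    by (intro exI[of _ 1]) (simp add: hardy_H1_def weak_L1_norm_weighted_maximal_le)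
next
  assume "\<exists>C::real. C > 0 \<and> (\<forall>F \<in> (hardy_H1 :: (nat \<Rightarrow> dyadic_group \<Rightarrow> 'a) set).
      L1_norm (weighted_maximal F) \<le> ennreal C * H1_norm F)"
  then obtain C :: real where C: "C > 0"
    and bound: "\<And>F. F \<in> (hardy_H1 :: (nat \<Rightarrow> dyadic_group \<Rightarrow> 'a) set) \<Longrightarrow>
      L1_norm (weighted_maximal F) \<le> ennreal C * H1_norm F"
    by blast
  obtain m :: nat where m: "8 * C < real m"
    using reals_Archimedean2 by blast
  let ?F = "atom_martingale m :: nat \<Rightarrow> dyadic_group \<Rightarrow> 'a"
  have "H1_norm ?F < \<infinity>"
    by (rule le_less_trans[OF H1_norm_atom_le]) simp
  then have "?F \<in> hardy_H1"
    by (simp add: hardy_H1_def dyadic_martingale_atom)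
  then have "ennreal (real m / 8) \<le> ennreal C * H1_norm ?F"
    by (rule order_trans[OF L1_norm_weighted_maximal_atom_ge bound])
  also have "\<dots> \<le> ennreal C * 1"
    by (intro mult_left_mono H1_norm_atom_le) simp
  finally have "real m / 8 \<le> C"
    using C by simp
  with m show False by simp
qed

end
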